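(* Let $K$ be a field of characteristic $3$, let $\mathcal{E}: Y^2 = X^3+AX+B$ be an elliptic curve over $K$, and let $c\in K$, $c\neq 0$, be arbitrary. Consider the plane cubic $\mathrm{E}_c$ over $K((X))$, in the affine $3$-space over $K((X))$ with coordinates $(\alpha,\beta,\gamma)$, defined by $$\left\{\begin{array}{l} c^2AX\alpha+c^2(X^3+B)\beta=AX^2,\\[2pt] c^2(X^3+AX+B)\left(\dfrac{\alpha-\beta}{X}\right)^2=(\alpha+\beta+\gamma)^3+A(\alpha+\beta+\gamma)+B.\end{array}\right.$$ (a) If $B\neq 0$, the set of all separable formal endomorphisms $\eta=\alpha+\beta+\gamma$ of $\mathcal{E}$ with "derivative at origin" equal to $c$ identifies with the set of $K[[X]]$-rational points $(\alpha,\beta,\gamma)$ of $\mathrm{E}_c$ such that $\alpha\in V_1$, $\beta\in V_2$ and $\gamma\in V_0$ and satisfying the compatibility condition: there exists $k\in K$ such that $k^3+k=c^2B\alpha_1-B$, where $\alpha=\alpha_1X+\alpha_4X^4+\alpha_7X^7+\cdots$. (b) If $B=0$, then the set of all separable formal endomorphisms $\eta=\alpha+\beta+\gamma$ of $\mathcal{E}$ with "derivative at origin" equal to $c$ identifies with the set of points $(\alpha,\beta,\gamma)$ of $\mathrm{E}_c$ with $\beta\in V_2\cap\frac1X K[[X]]$, $\alpha\in V_1$, $\gamma\in V_0$, subject to the following compatibility conditions, where $\alpha=\alpha_1X+\alpha_4X^4+\cdots=X\delta(X^3)$ with $\delta\in K[[X]]$ having constant term $\delta_0$ (so $\delta_0=\alpha_1$),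 and $\beta=\beta_{-1}X^{-1}+\beta_2X^2+\beta_5X^5+\cdots$: $$\beta_{-1}=\frac{A}{c^2}-A\delta_0,$$ $$c^2A\beta_{-1}^2-\beta_{-1}^3=0,$$ $$c^2(\beta_{-1}^2+A\alpha_1\beta_{-1})-A\beta_{-1}=0,$$ and the equation $T^3+AT=2c^2A\beta_{-1}\beta_2$ in the unknown $T$ has a solution in $K$.
   Context: $K$ is a field of characteristic $3$; since $\mathcal{E}: Y^2=X^3+AX+B$ is an elliptic curve (nonsingular), $A\neq 0$. $K[[X]]$ is the ring of formal power series, $K((X))$ its fraction field (formal Laurent series), $\frac1X K[[X]]$ the set of Laurent series with at most a simple pole at $X=0$, and $'$ denotes the formal derivative with respect to $X$. Splitting: $K((X))=V_0\oplus V_1\oplus V_2$, where $V_0=\{S: S'=0\}$, $V_1=\{S: S'=S/X\}$, $V_2=V_{-1}=\{S: S'=-S/X\}$; these are the Laurent series whose exponents are all congruent to $0,1,2$ modulo $3$ respectively. Each $\eta\in K((X))$ decomposes uniquely as $\eta=\alpha+\beta+\gamma$ with $\alpha\in V_1$, $\beta\in V_2$, $\gamma\in V_0$; the identification in the claim is through this decomposition. A separable isogeny $\mathcal{E}\to\mathcal{E}$ has the form $(x,y)\mapsto(\eta(x),c\,y\,\eta'(x))$ with $\eta\in K(X)$, $c\in K^*$. Correspondingly, for $c\in K^*$, a formal endomorphism (formal isogeny) of $\mathcal{E}$ with "derivative at origin" equal to $c$ is an element $\eta\in\frac1X K[[X]]$ satisfying $$c^2(X^3+AX+B)(\eta')^2=\eta^3+A\eta+B.$$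 It is separable if $\eta'\neq 0$.
   Formalization: In (a) the compatibility condition k^3+k=c^2Bα_1−B is corrected to k^3+Ak=c^2Bα_1^2−B; as printed it fails over F_9 with A=B=c=1, where a separable formal endomorphism with α_1=i (i^2=−1) exists but k^3+k=i−1 has no solution. *)

theory Defs
  imports
    "HOL-Algebra.Algebraic_Closure_Type"
    "HOL-Computational_Algebra.Computational_Algebra"
begin

text \<open>
  Nonsingularity is tested at the geometric affine points by the Jacobian criterion; the point at
  infinity of a curve in this form is always nonsingular.
\<close>

definition elliptic_curve :: "'a::field \<Rightarrow> 'a \<Rightarrow> bool" where
  "elliptic_curve A B \<longleftrightarrow>
     (\<nexists>x y :: 'a alg_closure.
        y^2 = x^3 + to_ac A * x + to_ac B \<and> 2 * y = 0 \<and> 3 * x^2 + to_ac A = 0)"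

definition V0 :: "'a::field fls set" where
  "V0 = {S. fls_deriv S = 0}"

definition V1 :: "'a::field fls set" where
  "V1 = {S. fls_deriv S = S / fls_X}"

definition V2 :: "'a::field fls set" where
  "V2 = {S. fls_deriv S = - S / fls_X}"

definition integral_series :: "'a::field fls set" where
  "integral_series = range fps_to_fls"

definition simple_pole_series :: "'a::field fls set" where
  "simple_pole_series = range (\<lambda>f. fps_to_fls f / fls_X)"

definition formal_endomorphisms :: "'a::field \<Rightarrow> 'a \<Rightarrow> 'a \<Rightarrow> 'a fls set" where
  "formal_endomorphisms A B c =
     {\<eta> \<in> simple_pole_series.
        fls_const (c^2) * (fls_X^3 + fls_const A * fls_X + fls_const B) * (fls_deriv \<eta>)^2
          = \<eta>^3 + fls_const A * \<eta> + fls_const B}"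

definition separable_formal_endomorphisms :: "'a::field \<Rightarrow> 'a \<Rightarrow> 'a \<Rightarrow> 'a fls set" where
  "separable_formal_endomorphisms A B c =
     {\<eta> \<in> formal_endomorphisms A B c. fls_deriv \<eta> \<noteq> 0}"

definition cubic_E :: "'a::field \<Rightarrow> 'a \<Rightarrow> 'a \<Rightarrow> ('a fls \<times> 'a fls \<times> 'a fls) set" where
  "cubic_E A B c =
     {(\<alpha>, \<beta>, \<gamma>).
        fls_const (c^2 * A) * fls_X * \<alpha> + fls_const (c^2) * (fls_X^3 + fls_const B) * \<beta>
          = fls_const A * fls_X^2 \<and>
        fls_const (c^2) * (fls_X^3 + fls_const A * fls_X + fls_const B) * ((\<alpha> - \<beta>) / fls_X)^2
          = (\<alpha> + \<beta> + \<gamma>)^3 + fls_const A * (\<alpha> + \<beta> + \<gamma>) + fls_const B}"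

text \<open>
  The compatibility condition is the constant coefficient of the second equation of
  \<open>cubic_E\<close>, with \<open>k\<close> the constant coefficient of \<open>\<gamma>\<close>: \<open>k^3 + A k = c^2 B \<alpha>_1^2 - B\<close>.
  The source prints it as \<open>k^3 + k = c^2 B \<alpha>_1 - B\<close>, without the factor \<open>A\<close> and the square;
  with that condition the correspondence fails. For instance, over the field with 9 elements, with
  \<open>A = B = c = 1\<close> and \<open>i^2 = -1\<close>, there is a separable formal endomorphism with \<open>\<alpha>_1 = i\<close>,
  but \<open>k^3 + k = i - 1\<close> has no solution, as \<open>k^3 + k\<close> is always in the prime field.
\<close>

definition points_B_nonzero :: "'a::field \<Rightarrow> 'a \<Rightarrow> 'a \<Rightarrow> ('a fls \<times> 'a fls \<times> 'a fls) set" where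
  "points_B_nonzero A B c =
     {(\<alpha>, \<beta>, \<gamma>). (\<alpha>, \<beta>, \<gamma>) \<in> cubic_E A B c \<and>
        \<alpha> \<in> integral_series \<and> \<beta> \<in> integral_series \<and> \<gamma> \<in> integral_series \<and>
        \<alpha> \<in> V1 \<and> \<beta> \<in> V2 \<and> \<gamma> \<in> V0 \<and>
        (\<exists>k. k^3 + A * k = c^2 * B * (fls_nth \<alpha> 1)^2 - B)}"

definition points_B_zero :: "'a::field \<Rightarrow> 'a \<Rightarrow> ('a fls \<times> 'a fls \<times> 'a fls) set" where
  "points_B_zero A c =
     {(\<alpha>, \<beta>, \<gamma>). (\<alpha>, \<beta>, \<gamma>) \<in> cubic_E A 0 c \<and>
        \<beta> \<in> V2 \<inter> simple_pole_series \<and> \<alpha> \<in> V1 \<and> \<gamma> \<in> V0 \<and>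
        (\<exists>\<delta>. \<alpha> = fls_X * fps_to_fls (fps_compose \<delta> (fps_X^3)) \<and>
             fls_nth \<beta> (-1) = A / c^2 - A * fps_nth \<delta> 0) \<and>
        c^2 * A * (fls_nth \<beta> (-1))^2 - (fls_nth \<beta> (-1))^3 = 0 \<and>
        c^2 * ((fls_nth \<beta> (-1))^2 + A * fls_nth \<alpha> 1 * fls_nth \<beta> (-1)) - A * fls_nth \<beta> (-1) = 0 \<and>
        (\<exists>T. T^3 + A * T = 2 * c^2 * A * fls_nth \<beta> (-1) * fls_nth \<beta> 2)}"

end

(*
  The operator X d/dX acts on V0, V1, V2 as 0, 1, -1, and in characteristic 3 it equals its own cube,
  so the splitting is its eigenspace decomposition.  Differentiating the equation of an isogeny kills
  the cubic term; cancelling the derivative of eta leaves the linear equation of the plane cubic.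
  Conversely the linear equation has no solution with alpha = beta = 0, which gives separability.
  The compatibility conditions are low-order coefficients of the two equations.
*)

theory Submission
  imports Defs
begin

unbundle fps_syntax

section \<open>Characteristic 3 and nonsingularity\<close>

lemma three_eq_0_if_CHAR_3:
  assumes "CHAR('a::comm_ring_1) = 3"
  shows "(3::'a) = 0"
  using of_nat_CHAR[where 'a = 'a] assms by simp

lemma two_eq_minus_1_if_CHAR_3:
  assumes "CHAR('a::comm_ring_1) = 3"
  shows "(2::'a) = -1"
  using three_eq_0_if_CHAR_3[OF assms] by (simp add: eq_neg_iff_add_eq_0)

text \<open>If \<open>A = 0\<close>, the point \<open>(x, 0)\<close> with \<open>x\<close> a cube
  root of \<open>-B\<close> in the algebraic closure is singular, because \<open>3 * x^2\<close>
  vanishes there.\<close>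

lemma elliptic_curve_CHAR_3_imp_nonzero:
  fixes A B :: "'a::field"
  assumes "CHAR('a) = 3" "elliptic_curve A B"
  shows "A \<noteq> 0"
proof
  assume "A = 0"
  obtain x :: "'a alg_closure" where x: "x ^ 3 = - to_ac B"
    using nth_root_exists[of 3 "- to_ac B"] by auto
  have "(3 :: 'a alg_closure) = to_ac 3"
    by (rule to_ac_numeral [symmetric])
  also have "\<dots> = 0"
    using three_eq_0_if_CHAR_3[OF assms(1)] by simp
  finally have "(0::'a alg_closure)^2 = x^3 + to_ac A * x + to_ac B
      \<and> 2 * (0::'a alg_closure) = 0 \<and> 3 * x^2 + to_ac A = 0"
    using x \<open>A = 0\<close> by simp
  thus False
    using assms(2) unfolding elliptic_curve_def by blast
qed

section \<open>The splitting into eigenspaces of X d/dX\<close>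

lemma V0_iff: "S \<in> V0 \<longleftrightarrow> fls_X * fls_deriv S = (0 :: 'a::field fls)"
  by (simp add: V0_def)

lemma V1_iff: "S \<in> V1 \<longleftrightarrow> fls_X * fls_deriv S = (S :: 'a::field fls)"
  by (simp add: V1_def nonzero_eq_divide_eq mult.commute del: fls_divide_X)

lemma V2_iff: "S \<in> V2 \<longleftrightarrow> fls_X * fls_deriv S = - (S :: 'a::field fls)"
  unfolding V2_def mem_Collect_eq
  by (subst nonzero_eq_divide_eq) (simp_all add: mult.commute)

lemma fls_X_times_deriv_nth: "(fls_X * fls_deriv S) $$ n = of_int n * (S $$ n :: 'a::field)"
  by (simp add: fls_X_times_conv_shift)

text \<open>On an eigenspace with eigenvalue \<open>e\<close>, comparing coefficients gives
  \<open>(n - e) * S $$ n = 0\<close>, and in characteristic 3 the factor is invertible unless 3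
  divides \<open>n - e\<close>. The next two lemmas are the cases \<open>e = 1\<close> and
  \<open>e = -1\<close>.\<close>

lemma V0_nth_eq_0:
  fixes S :: "'a::field fls"
  assumes "CHAR('a) = 3" "S \<in> V0" "\<not> 3 dvd n"
  shows "S $$ n = 0"
proof -
  have "of_int n * S $$ n = 0"
    using fls_X_times_deriv_nth[of S n] assms(2) by (simp add: V0_iff)
  thus ?thesis
    using of_int_eq_0_iff_char_dvd[of n, where 'a = 'a] assms by simp
qed

lemma V1_nth_eq_0:
  fixes S :: "'a::field fls"
  assumes "CHAR('a) = 3" "S \<in> V1" "\<not> 3 dvd n - 1"
  shows "S $$ n = 0"
proof -
  have "of_int (n - 1) * S $$ n = 0"
    using fls_X_times_deriv_nth[of S n] assms(2) by (simp add: V1_iff algebra_simps)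
  thus ?thesis
    using of_int_eq_0_iff_char_dvd[of "n - 1", where 'a = 'a] assms by auto
qed

lemma V2_nth_eq_0:
  fixes S :: "'a::field fls"
  assumes "CHAR('a) = 3" "S \<in> V2" "\<not> 3 dvd n + 1"
  shows "S $$ n = 0"
proof -
  have "- (S $$ n) = of_int n * S $$ n"
    using fls_X_times_deriv_nth[of S n] assms(2) by (simp add: V2_iff)
  hence "S $$ n + of_int n * S $$ n = 0"
    by (metis add.right_inverse)
  hence "of_int (n + 1) * S $$ n = 0"
    by (simp add: algebra_simps)
  thus ?thesis
    using of_int_eq_0_iff_char_dvd[of "n + 1", where 'a = 'a] assms by auto
qed

text \<open>Since \<open>\<theta>\<close> satisfies \<open>T^3 = T\<close>, whose roots 0, 1, -1 are
  distinct, the projections onto its eigenspaces are polynomials in \<open>\<theta>\<close>.\<close>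

lemma ex_V_decomposition:
  fixes \<eta> :: "'a::field fls"
  assumes "CHAR('a) = 3"
  obtains \<alpha> \<beta> \<gamma> where "\<alpha> \<in> V1" "\<beta> \<in> V2" "\<gamma> \<in> V0" "\<eta> = \<alpha> + \<beta> + \<gamma>"
proof -
  define \<theta> where "\<theta> = (\<lambda>S :: 'a fls. fls_X * fls_deriv S)"
  have three: "(3 :: 'a fls) = 0"
    by (rule three_eq_0_if_CHAR_3) (simp add: assms)
  have lin: "\<theta> (S + T) = \<theta> S + \<theta> T" "\<theta> (S - T) = \<theta> S - \<theta> T" "\<theta> (- S) = - \<theta> S" for S T
    by (simp_all add: \<theta>_def algebra_simps)
  have V: "S \<in> V0 \<longleftrightarrow> \<theta> S = 0" "S \<in> V1 \<longleftrightarrow> \<theta> S = S" "S \<in> V2 \<longleftrightarrow> \<theta> S = - S" for S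
    by (simp_all add: \<theta>_def V0_iff V1_iff V2_iff)
  have cube: "\<theta> (\<theta> (\<theta> S)) = \<theta> S" for S
  proof (rule fls_eqI)
    fix n :: int
    \<comment> \<open>The difference is the product of three consecutive integers.\<close>
    have "3 dvd (n * n * n - n)"
    proof -
      have "3 dvd n - 1 \<or> 3 dvd n \<or> 3 dvd n + 1" by presburger
      hence "3 dvd (n - 1) * n * (n + 1)" by auto
      thus ?thesis by (simp add: algebra_simps)
    qed
    hence "of_int (n * n * n - n) = (0::'a)"
      using of_int_eq_0_iff_char_dvd[of "n * n * n - n", where 'a = 'a] assms by simp
    hence n: "of_int n * of_int n * of_int n = (of_int n :: 'a)"
      by (simp only: of_int_diff of_int_mult right_minus_eq)
    thus "\<theta> (\<theta> (\<theta> S)) $$ n = \<theta> S $$ n"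
      by (simp only: \<theta>_def fls_X_times_deriv_nth n flip: mult.assoc)
  qed
  show ?thesis
  proof
    \<comment> \<open>The Lagrange projectors are (T^2 + T)/2, (T^2 - T)/2 and 1 - T^2, with 1/2 =
      -1. Their sum in this form is 1 - 3T^2, which is 1 here.\<close>
    show "- (\<theta> (\<theta> \<eta>) + \<theta> \<eta>) \<in> V1"
      by (simp add: V lin cube)
    show "\<theta> \<eta> - \<theta> (\<theta> \<eta>) \<in> V2"
      by (simp add: V lin cube)
    show "\<eta> - \<theta> (\<theta> \<eta>) \<in> V0"
      by (simp add: V lin cube)
    show "\<eta> = - (\<theta> (\<theta> \<eta>) + \<theta> \<eta>) + (\<theta> \<eta> - \<theta> (\<theta> \<eta>)) + (\<eta> - \<theta> (\<theta> \<eta>))"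
      using three by (simp add: algebra_simps)
  qed
qed

text \<open>Applying \<open>\<theta>\<close> once and twice to the sum recovers \<alpha> - \<beta>
  and \<alpha> + \<beta>. These determine \<alpha> because 2 = -1 is invertible.\<close>

lemma V_decomposition_unique:
  fixes \<alpha> \<beta> \<gamma> \<alpha>' \<beta>' \<gamma>' :: "'a::field fls"
  assumes char: "CHAR('a) = 3"
    and "\<alpha> \<in> V1" "\<beta> \<in> V2" "\<gamma> \<in> V0" "\<alpha>' \<in> V1" "\<beta>' \<in> V2" "\<gamma>' \<in> V0"
    and eq: "\<alpha> + \<beta> + \<gamma> = \<alpha>' + \<beta>' + \<gamma>'"
  shows "\<alpha> = \<alpha>' \<and> \<beta> = \<beta>' \<and> \<gamma> = \<gamma>'"
proof -
  have two: "(2 :: 'a fls) = -1"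
    by (rule two_eq_minus_1_if_CHAR_3) (simp add: char)
  define \<theta> where "\<theta> = (\<lambda>S :: 'a fls. fls_X * fls_deriv S)"
  have lin: "\<theta> (S + T) = \<theta> S + \<theta> T" "\<theta> (S - T) = \<theta> S - \<theta> T" for S T
    by (simp_all add: \<theta>_def algebra_simps)
  have V: "\<theta> \<alpha> = \<alpha>" "\<theta> \<beta> = - \<beta>" "\<theta> \<gamma> = 0" "\<theta> \<alpha>' = \<alpha>'" "\<theta> \<beta>' = - \<beta>'" "\<theta> \<gamma>' = 0"
    using assms by (simp_all add: V0_iff V1_iff V2_iff \<theta>_def)
  have "\<theta> (\<alpha> + \<beta> + \<gamma>) = \<theta> (\<alpha>' + \<beta>' + \<gamma>')" using eq by simp
  hence 1: "\<alpha> - \<beta> = \<alpha>' - \<beta>'" by (simp add: lin V)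
  have "\<theta> (\<alpha> - \<beta>) = \<theta> (\<alpha>' - \<beta>')" by (simp only: 1)
  hence 2: "\<alpha> + \<beta> = \<alpha>' + \<beta>'" by (simp add: lin V)
  have "(\<alpha> - \<beta>) + (\<alpha> + \<beta>) = (\<alpha>' - \<beta>') + (\<alpha>' + \<beta>')" by (simp only: 1 2)
  hence "2 * \<alpha> = 2 * \<alpha>'" by simp
  hence "\<alpha> = \<alpha>'" by (simp add: two)
  with 2 eq show ?thesis by simp
qed

section \<open>Pole orders of the components\<close>

lemma integral_series_iff: "S \<in> integral_series \<longleftrightarrow> (\<forall>n<0. (S :: 'a::field fls) $$ n = 0)"
proof
  assume "\<forall>n<0. S $$ n = 0"
  hence "S = fps_to_fls (Abs_fps (\<lambda>n. S $$ int n))"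
    by (intro fls_eqI) auto
  thus "S \<in> integral_series" unfolding integral_series_def by (rule range_eqI)
qed (auto simp: integral_series_def)

lemma simple_pole_series_iff:
  "S \<in> simple_pole_series \<longleftrightarrow> (\<forall>n < -1. (S :: 'a::field fls) $$ n = 0)"
proof
  assume "\<forall>n < -1. S $$ n = 0"
  hence "S = fps_to_fls (Abs_fps (\<lambda>n. S $$ (int n - 1))) / fls_X"
    by (intro fls_eqI) auto
  thus "S \<in> simple_pole_series" unfolding simple_pole_series_def by (rule range_eqI)
qed (auto simp: simple_pole_series_def)

text \<open>The three parts have exponents in different classes modulo 3, so their poles cannot
  cancel. The exponent -1 lies in the class of \<open>V2\<close>, so only \<beta> can keep a simple
  pole.\<close>

lemma simple_pole_series_parts:
  fixes \<alpha> \<beta> \<gamma> :: "'a::field fls"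
  assumes "CHAR('a) = 3" "\<alpha> \<in> V1" "\<beta> \<in> V2" "\<gamma> \<in> V0" "\<alpha> + \<beta> + \<gamma> \<in> simple_pole_series"
  shows "\<alpha> \<in> integral_series" "\<beta> \<in> simple_pole_series" "\<gamma> \<in> integral_series"
proof -
  have *: "\<alpha> $$ n = 0 \<and> \<beta> $$ n = 0 \<and> \<gamma> $$ n = 0" if "n < -1" for n
  proof -
    have sum: "\<alpha> $$ n + \<beta> $$ n + \<gamma> $$ n = 0"
      using assms(5) that by (simp add: simple_pole_series_iff)
    have "3 dvd n \<or> 3 dvd n - 1 \<or> 3 dvd n + 1" by presburger
    moreover have "\<not> (3 dvd n \<and> 3 dvd n - 1)" "\<not> (3 dvd n \<and> 3 dvd n + 1)"
      "\<not> (3 dvd n - 1 \<and> 3 dvd n + 1)" by presburger+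
    ultimately show ?thesis
      using sum V0_nth_eq_0[OF assms(1,4), of n] V1_nth_eq_0[OF assms(1,2), of n]
        V2_nth_eq_0[OF assms(1,3), of n] by auto
  qed
  have m1: "\<alpha> $$ (-1) = 0" "\<gamma> $$ (-1) = 0"
    using V1_nth_eq_0[OF assms(1,2), of "-1"] V0_nth_eq_0[OF assms(1,4), of "-1"] by auto
  have "n < -1 \<or> n = -1" if "n < 0" for n :: int using that by linarith
  with * m1 show "\<alpha> \<in> integral_series" "\<gamma> \<in> integral_series"
    unfolding integral_series_iff by metis+
  show "\<beta> \<in> simple_pole_series"
    using * by (simp add: simple_pole_series_iff)
qed

section \<open>The plane cubic and the isogeny equation\<close>

lemma fls_X_times_deriv_decomposition:
  assumes "\<alpha> \<in> V1" "\<beta> \<in> V2" "\<gamma> \<in> V0"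
  shows "fls_X * fls_deriv (\<alpha> + \<beta> + \<gamma>) = \<alpha> - \<beta>"
    "fls_deriv (\<alpha> + \<beta> + \<gamma>) = (\<alpha> - \<beta>) / fls_X"
proof -
  show *: "fls_X * fls_deriv (\<alpha> + \<beta> + \<gamma>) = \<alpha> - \<beta>"
    using assms by (simp add: V0_iff V1_iff V2_iff distrib_left)
  show "fls_deriv (\<alpha> + \<beta> + \<gamma>) = (\<alpha> - \<beta>) / fls_X"
    by (simp add: nonzero_eq_divide_eq mult.commute[of _ fls_X] * del: fls_deriv_add fls_divide_X)
qed

text \<open>The second equation of the cubic is the isogeny equation with the derivative written as
  (\<alpha> - \<beta>)/X. In its presence, the linear equation amounts to separability.\<close>

lemma cubic_E_iff:
  fixes \<alpha> \<beta> \<gamma> :: "'a::field fls"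
  assumes char: "CHAR('a) = 3" and "A \<noteq> 0"
    and V: "\<alpha> \<in> V1" "\<beta> \<in> V2" "\<gamma> \<in> V0"
  defines "\<eta> \<equiv> \<alpha> + \<beta> + \<gamma>"
  shows "(\<alpha>, \<beta>, \<gamma>) \<in> cubic_E A B c \<longleftrightarrow>
    fls_const (c^2) * (fls_X^3 + fls_const A * fls_X + fls_const B) * (fls_deriv \<eta>)^2
      = \<eta>^3 + fls_const A * \<eta> + fls_const B \<and> fls_deriv \<eta> \<noteq> 0"
proof -
  have three: "(3 :: 'a fls) = 0"
    by (rule three_eq_0_if_CHAR_3) (simp add: char)
  have two: "(2 :: 'a fls) = -1"
    by (rule two_eq_minus_1_if_CHAR_3) (simp add: char)
  define C where "C = fls_const (c^2)"
  define a where "a = fls_const A"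
  define b where "b = fls_const B"
  define P where "P = C * (fls_X^3 + a * fls_X + b)"
  define d where "d = fls_deriv \<eta>"
  define d2 where "d2 = fls_deriv d"
  have Xd: "fls_X * d = \<alpha> - \<beta>"
    using fls_X_times_deriv_decomposition[OF V] by (simp add: d_def \<eta>_def)
  have lin_iff: "(fls_const (c^2 * A) * fls_X * \<alpha> + fls_const (c^2) * (fls_X^3 + fls_const B) * \<beta>
          = fls_const A * fls_X^2) \<longleftrightarrow> C * a * fls_X * \<alpha> + C * (fls_X^3 + b) * \<beta> = a * fls_X^2"
    by (simp add: C_def a_def b_def)
  have E: "(\<alpha>, \<beta>, \<gamma>) \<in> cubic_E A B c \<longleftrightarrow>
      C * a * fls_X * \<alpha> + C * (fls_X^3 + b) * \<beta> = a * fls_X^2 \<and>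
      P * d^2 = \<eta>^3 + a * \<eta> + b"
    unfolding cubic_E_def mem_Collect_eq prod.case lin_iff
    using fls_X_times_deriv_decomposition(2)[OF V]
    by (simp add: P_def C_def a_def b_def d_def \<eta>_def del: fls_divide_X fls_deriv_add)
  have "C * a * fls_X * \<alpha> + C * (fls_X^3 + b) * \<beta> = a * fls_X^2"
    if eq: "P * d^2 = \<eta>^3 + a * \<eta> + b" and "d \<noteq> 0"
  proof -
    have D1: "fls_deriv (P * d^2) = C * a * d^2 + P * (2 * d * d2)"
      using three
      by (simp add: P_def C_def a_def b_def d2_def power2_eq_square power3_eq_cube algebra_simps)
    have D2: "fls_deriv (\<eta>^3 + a * \<eta> + b) = a * d"
      using three by (simp add: a_def b_def d_def power3_eq_cube algebra_simps)
    have "C * a * d^2 + P * (2 * d * d2) = a * d"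
      using D1 D2 unfolding eq by simp
    \<comment> \<open>Every term of the differentiated equation contains \<open>d\<close>;
      separability allows its cancellation.\<close>
    hence "d * (C * a * d + 2 * P * d2) = d * a"
      by (simp add: power2_eq_square algebra_simps)
    hence lin: "C * a * d + 2 * P * d2 = a" using \<open>d \<noteq> 0\<close> by simp
    \<comment> \<open>A second application of X d/dX expresses the second derivative of \<eta>
      through \<beta> alone.\<close>
    have "fls_X * fls_deriv (fls_X * d) = \<alpha> + \<beta>"
      unfolding Xd using V by (simp add: V1_iff V2_iff right_diff_distrib)
    hence "fls_X^2 * d2 = \<alpha> + \<beta> - fls_X * d"
      by (simp add: d2_def power2_eq_square algebra_simps)
    hence X2d2: "fls_X^2 * d2 = 2 * \<beta>" by (simp add: Xd)
    have "a * fls_X^2 = (C * a * d + 2 * P * d2) * fls_X^2"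
      by (simp only: lin)
    also have "\<dots> = C * a * fls_X * (fls_X * d) + 2 * P * (fls_X^2 * d2)"
      by (simp add: power2_eq_square algebra_simps)
    \<comment> \<open>The coefficient 4 of \<open>P * \<beta>\<close> is split as 1 + 3. The linear
      term of \<open>P\<close> in the single copy cancels the \<beta> coming from
      \<open>fls_X * d\<close>.\<close>
    also have "\<dots> = C * a * fls_X * \<alpha> + C * (fls_X^3 + b) * \<beta> + 3 * (P * \<beta>)"
      unfolding Xd X2d2 by (simp add: P_def algebra_simps)
    finally show ?thesis using three by simp
  qed
  moreover have "d \<noteq> 0"
    if eq: "C * a * fls_X * \<alpha> + C * (fls_X^3 + b) * \<beta> = a * fls_X^2"
  proof
    \<comment> \<open>Then \<alpha> = \<beta> lies in both \<open>V1\<close> and \<open>V2\<close>,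
      hence is zero, and the linear equation degenerates to \<open>a * fls_X^2 = 0\<close>.\<close>
    assume "d = 0"
    hence "\<alpha> = \<beta>" using Xd by simp
    moreover have "fls_X * fls_deriv \<alpha> = \<alpha>" "fls_X * fls_deriv \<beta> = - \<beta>"
      using V by (simp_all add: V1_iff V2_iff)
    ultimately have "\<alpha> = - \<alpha>" by simp
    hence "2 * \<alpha> = 0" by (metis add.left_inverse mult_2)
    hence "\<alpha> = 0" by (simp add: two)
    hence "\<beta> = 0" using \<open>\<alpha> = \<beta>\<close> by simp
    with eq \<open>\<alpha> = 0\<close> have "a * fls_X^2 = 0" by simp
    thus False using \<open>A \<noteq> 0\<close> by (simp add: a_def)
  qed
  ultimately show ?thesis
    unfolding E by (auto simp: P_def C_def a_def b_def d_def)
qed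

section \<open>Low-order coefficients and poles in the isogeny equation\<close>

text \<open>Multiplication by X^4 turns the equation into an identity of power series. The four
  claims are its coefficients 0, 1, 3 and 4, that is, those of X^-4, X^-3, X^-1 and X^0 before the
  multiplication.\<close>

lemma isogeny_equation_coeffs:
  fixes \<eta> :: "'a::field fls"
  assumes char: "CHAR('a) = 3" and "\<eta> \<in> simple_pole_series"
    and eq: "fls_const (c^2) * (fls_X^3 + fls_const A * fls_X + fls_const B) * (fls_deriv \<eta>)^2
      = \<eta>^3 + fls_const A * \<eta> + fls_const B"
  defines "p \<equiv> \<eta> $$ (-1)"
  shows "c^2 * B * p^2 = 0"
    and "c^2 * A * p^2 = p^3"
    and "c^2 * (p^2 + A * p * \<eta> $$ 1 + 2 * B * p * \<eta> $$ 2) = A * p"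
    and "c^2 * (2 * A * p * \<eta> $$ 2 + B * (\<eta> $$ 1)^2) = (\<eta> $$ 0)^3 + A * \<eta> $$ 0 + B"
proof -
  have three: "(3 :: 'a) = 0"
    by (rule three_eq_0_if_CHAR_3) (simp add: char)
  obtain f where f: "\<eta> = fps_to_fls f / fls_X"
    using assms(2) by (auto simp: simple_pole_series_def)
  define F where "F = fps_to_fls f"
  define d where "d = fls_deriv \<eta>"
  \<comment> \<open>With \<open>f\<close> standing for X\<eta>, this is X^2 times the derivative of
    \<eta>, again free of poles.\<close>
  define g where "g = fps_X * fps_deriv f - f"
  have X\<eta>: "fls_X * \<eta> = F" by (simp add: f F_def del: fls_divide_X)
  have "\<eta> + fls_X * d = fls_deriv F"
    unfolding X\<eta>[symmetric] by (simp add: d_def)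
  hence Xd: "fls_X^2 * d = fls_X * fls_deriv F - F"
    unfolding X\<eta>[symmetric] by (simp add: power2_eq_square algebra_simps)
  have "fls_const (c^2) * (fls_X^3 + fls_const A * fls_X + fls_const B) * (fls_X^2 * d)^2
      = fls_X^4 * (fls_const (c^2) * (fls_X^3 + fls_const A * fls_X + fls_const B) * d^2)"
    by (simp add: power_mult_distrib mult_ac flip: power_mult)
  also have "\<dots> = (fls_X * \<eta>)^3 * fls_X + fls_const A * (fls_X * \<eta>) * fls_X^3
      + fls_const B * fls_X^4"
    unfolding d_def eq by (simp add: power_mult_distrib algebra_simps eval_nat_numeral)
  finally have "fps_to_fls (fps_const (c^2) * (fps_X^3 + fps_const A * fps_X + fps_const B) * g^2)
      = fps_to_fls (f^3 * fps_X + fps_const A * f * fps_X^3 + fps_const B * fps_X^4)"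
    unfolding Xd X\<eta>
    by (simp add: F_def g_def fls_times_fps_to_fls fps_to_fls_power fls_deriv_fps_to_fls)
  hence "fps_const (c^2) * (fps_X^3 + fps_const A * fps_X + fps_const B) * g^2
      = f^3 * fps_X + fps_const A * f * fps_X^3 + fps_const B * fps_X^4"
    by (simp only: fps_to_fls_eq_iff)
  \<comment> \<open>Powers of X are moved to the right of each product so that taking a coefficient
    becomes an index shift.\<close>
  hence "fps_const (c^2) * (g^2 * fps_X^3 + fps_const A * (g^2 * fps_X) + fps_const B * g^2)
      = f^3 * fps_X + fps_const A * (f * fps_X^3) + fps_const B * fps_X^4"
    by (simp add: algebra_simps del: fps_const_mult)
  hence coeff: "(fps_const (c^2) * (g^2 * fps_X^3 + fps_const A * (g^2 * fps_X) + fps_const B * g^2)) $ n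
      = (f^3 * fps_X + fps_const A * (f * fps_X^3) + fps_const B * fps_X^4) $ n" for n
    by simp
  have g: "g $ n = (of_nat n - 1) * f $ n" for n
    by (cases n) (simp_all add: g_def algebra_simps)
  \<comment> \<open>Indices move up by one in passing from \<eta> to \<open>f\<close>.\<close>
  have \<eta>: "p = f $ 0" "\<eta> $$ 0 = f $ 1" "\<eta> $$ 1 = f $ 2" "\<eta> $$ 2 = f $ 3"
    by (simp_all add: f p_def)
  have mult_nth: "(u * v) $ 2 = u$0 * v$2 + u$1 * v$1 + u$2 * v$0"
      "(u * v) $ 3 = u$0 * v$3 + u$1 * v$2 + u$2 * v$1 + u$3 * v$0"
      "(u * v) $ 4 = u$0 * v$4 + u$1 * v$3 + u$2 * v$2 + u$3 * v$1 + u$4 * v$0" for u v :: "'a fps"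
    by (simp_all add: fps_mult_nth eval_nat_numeral)
  \<comment> \<open>The mixed terms keep their explicit factor 3 and vanish only when
    \<open>three\<close> is applied below.\<close>
  have f3: "(f^3) $ 0 = f$0 * f$0 * f$0" "(f^3) $ 2 = 3 * (f$0 * f$0 * f$2 + f$0 * f$1 * f$1)"
      "(f^3) $ 3 = f$1 * f$1 * f$1 + 3 * (f$0 * f$0 * f$3 + 2 * f$0 * f$1 * f$2)"
    by (simp_all add: power3_eq_cube mult_nth fps_mult_nth_1 algebra_simps)
  have g2: "(g^2) $ 0 = f$0 * f$0" "(g^2) $ Suc 0 = 0" "(g^2) $ 2 = - 2 * f$0 * f$2"
      "(g^2) $ 3 = - 4 * f$0 * f$3" "(g^2) $ 4 = f$2 * f$2 - 6 * f$0 * f$4"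
    by (simp_all add: power2_eq_square mult_nth fps_mult_nth_1 g algebra_simps)
  show "c^2 * B * p^2 = 0"
    using coeff[of 0] by (simp add: \<eta> g power2_eq_square)
  have "c^2 * (A * (f$0 * f$0)) = f$0 * f$0 * f$0"
    using coeff[of 1] by (simp add: fps_X_power_mult_right_nth f3 g2)
  thus "c^2 * A * p^2 = p^3"
    by (simp add: \<eta> power2_eq_square power3_eq_cube algebra_simps)
  have "c^2 * (f$0 * f$0 - A * (2 * f$0 * f$2) - B * (4 * f$0 * f$3))
      = 3 * (f$0 * f$0 * f$2 + f$0 * f$1 * f$1) + A * f$0"
    using coeff[of 3] by (simp add: fps_X_power_mult_right_nth f3 g2)
  \<comment> \<open>The integer coefficients -2 and -4 are exchanged for 1 and 2 at the cost of a
    multiple of 3. The constant coefficient is treated likewise.\<close>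
  moreover have "c^2 * (p^2 + A * p * \<eta> $$ 1 + 2 * B * p * \<eta> $$ 2)
      = c^2 * (f$0 * f$0 - A * (2 * f$0 * f$2) - B * (4 * f$0 * f$3))
        + 3 * (c^2 * (A * f$0 * f$2 + 2 * B * f$0 * f$3))"
    by (simp add: \<eta> power2_eq_square algebra_simps)
  ultimately show "c^2 * (p^2 + A * p * \<eta> $$ 1 + 2 * B * p * \<eta> $$ 2) = A * p"
    using three by (simp add: \<eta>)
  have "c^2 * (- (A * (4 * f$0 * f$3)) + B * (f$2 * f$2) - 6 * B * f$0 * f$4)
      = f$1 * f$1 * f$1 + 3 * (f$0 * f$0 * f$3 + 2 * f$0 * f$1 * f$2) + A * f$1 + B"
    using coeff[of 4] by (simp add: fps_X_power_mult_right_nth f3 g2) (simp add: algebra_simps)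
  moreover have "c^2 * (2 * A * p * \<eta> $$ 2 + B * (\<eta> $$ 1)^2)
      = c^2 * (- (A * (4 * f$0 * f$3)) + B * (f$2 * f$2) - 6 * B * f$0 * f$4)
        + 3 * (c^2 * (2 * A * f$0 * f$3 + 2 * B * f$0 * f$4))"
    by (simp add: \<eta> power2_eq_square algebra_simps)
  ultimately show "c^2 * (2 * A * p * \<eta> $$ 2 + B * (\<eta> $$ 1)^2) = (\<eta> $$ 0)^3 + A * \<eta> $$ 0 + B"
    using three by (simp add: \<eta> power3_eq_cube)
qed

text \<open>
  A pole of \<open>\<gamma>\<close> has order at least 3, so it would make the pole of \<open>\<eta>^3\<close> dominate the equation.
\<close>

lemma cubic_E_V0_part_integral:
  fixes \<alpha> \<beta> \<gamma> :: "'a::field fls"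
  assumes char: "CHAR('a) = 3" and E: "(\<alpha>, \<beta>, \<gamma>) \<in> cubic_E A B c" and "\<gamma> \<in> V0"
    and \<alpha>: "\<alpha> \<in> simple_pole_series" and \<beta>: "\<beta> \<in> simple_pole_series"
  shows "\<gamma> \<in> integral_series"
proof (rule ccontr)
  assume "\<gamma> \<notin> integral_series"
  then obtain m where "m < 0" "\<gamma> $$ m \<noteq> 0" by (auto simp: integral_series_iff)
  hence "\<gamma> \<noteq> 0" and neg: "fls_subdegree \<gamma> < 0"
    using fls_subdegree_leI[of \<gamma> m] by auto
  define s where "s = fls_subdegree \<gamma>"
  define \<eta> where "\<eta> = \<alpha> + \<beta> + \<gamma>"
  have "\<gamma> $$ s \<noteq> 0" using \<open>\<gamma> \<noteq> 0\<close> by (simp add: s_def)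
  \<comment> \<open>A negative multiple of 3 is at most -3, below every exponent of \<alpha> and
    \<beta>, so \<gamma> alone determines the leading term of \<eta>.\<close>
  hence "3 dvd s" using V0_nth_eq_0[OF char \<open>\<gamma> \<in> V0\<close>] by blast
  with neg have s: "s \<le> -3" unfolding s_def by presburger
  have \<eta>s: "\<eta> $$ s \<noteq> 0" and below: "\<And>n. n < s \<Longrightarrow> \<eta> $$ n = 0"
    using s \<alpha> \<beta> \<open>\<gamma> $$ s \<noteq> 0\<close> by (simp_all add: \<eta>_def simple_pole_series_iff s_def)
  hence deg: "fls_subdegree \<eta> = s" by (intro fls_subdegree_eqI)
  have "\<alpha> - \<beta> \<in> simple_pole_series"
    using \<alpha> \<beta> by (simp add: simple_pole_series_iff)
  then obtain h where h: "\<alpha> - \<beta> = fps_to_fls h / fls_X"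
    by (auto simp: simple_pole_series_def)
  have "fls_const (c^2) * (fls_X^3 + fls_const A * fls_X + fls_const B) * ((\<alpha> - \<beta>) / fls_X)^2
      = \<eta>^3 + fls_const A * \<eta> + fls_const B"
    using E by (simp add: cubic_E_def \<eta>_def del: fls_divide_X)
  \<comment> \<open>The factor X^4 clears all poles of the side containing (\<alpha> - \<beta>)/X.
    Hence the coefficient at the negative exponent \<open>3 * s + 4\<close> is zero.\<close>
  hence "fls_X^4 * (\<eta>^3 + fls_const A * \<eta> + fls_const B)
      = fls_X^4 * (fls_const (c^2) * (fls_X^3 + fls_const A * fls_X + fls_const B)
        * ((fps_to_fls h / fls_X) / fls_X)^2)"
    unfolding h by simp
  also have "\<dots> = fls_const (c^2) * (fls_X^3 + fls_const A * fls_X + fls_const B) * fps_to_fls h ^ 2"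
    by (simp add: power_divide field_simps eval_nat_numeral del: fls_divide_X)
  also have "\<dots> = fps_to_fls (fps_const (c^2) * (fps_X^3 + fps_const A * fps_X + fps_const B) * h^2)"
    by (simp add: fls_times_fps_to_fls fps_to_fls_power)
  finally have "(fls_X^4 * (\<eta>^3 + fls_const A * \<eta> + fls_const B)) $$ (3 * s + 4) = 0"
    using s by simp
  hence "(\<eta>^3) $$ (3 * s) + A * \<eta> $$ (3 * s) = 0"
    using s by (simp add: fls_X_power_times_conv_shift)
  \<comment> \<open>As \<open>3 * s < s\<close>, the linear term does not reach this exponent, and
    the leading coefficient of the cube is left alone.\<close>
  moreover have "\<eta> $$ (3 * s) = 0" using s by (intro below) auto
  ultimately have "(\<eta> $$ s)^3 = 0"
    using fls_pow_base[of \<eta> 3] deg by simp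
  with \<eta>s show False by simp
qed

section \<open>The bijections between points and endomorphisms\<close>

lemma inj_on_V_sum:
  assumes "CHAR('a::field) = 3" "T \<subseteq> V1 \<times> V2 \<times> V0"
  shows "inj_on (\<lambda>(\<alpha>, \<beta>, \<gamma>). \<alpha> + \<beta> + \<gamma> :: 'a fls) T"
proof (rule inj_onI)
  fix x y assume xy: "x \<in> T" "y \<in> T"
    and eq: "(\<lambda>(\<alpha>, \<beta>, \<gamma>). \<alpha> + \<beta> + \<gamma>) x = (\<lambda>(\<alpha>, \<beta>, \<gamma>). \<alpha> + \<beta> + \<gamma>) y"
  obtain \<alpha> \<beta> \<gamma> \<alpha>' \<beta>' \<gamma>' where [simp]: "x = (\<alpha>, \<beta>, \<gamma>)" "y = (\<alpha>', \<beta>', \<gamma>')"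
    by (cases x, cases y)
  show "x = y"
    using V_decomposition_unique[OF assms(1), of \<alpha> \<beta> \<gamma> \<alpha>' \<beta>' \<gamma>'] xy eq assms(2) by auto
qed

text \<open>Each of the exponents -1, 0, 1, 2 belongs to exactly one class modulo 3, so a single
  part contributes.\<close>

lemma V_sum_nth:
  fixes \<alpha> \<beta> \<gamma> :: "'a::field fls"
  assumes "CHAR('a) = 3" "\<alpha> \<in> V1" "\<beta> \<in> V2" "\<gamma> \<in> V0"
  shows "(\<alpha> + \<beta> + \<gamma>) $$ (-1) = \<beta> $$ (-1)" "(\<alpha> + \<beta> + \<gamma>) $$ 0 = \<gamma> $$ 0"
    "(\<alpha> + \<beta> + \<gamma>) $$ 1 = \<alpha> $$ 1" "(\<alpha> + \<beta> + \<gamma>) $$ 2 = \<beta> $$ 2"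
  using V0_nth_eq_0[OF assms(1,4)] V1_nth_eq_0[OF assms(1,2)] V2_nth_eq_0[OF assms(1,3)]
  by simp_all

text \<open>The exponents of \<alpha> are congruent to 1 modulo 3, so every third coefficient,
  starting at exponent 1, gives the series \<delta> with \<alpha> = X\<delta>(X^3).\<close>

lemma V1_integral_eq_compose:
  fixes \<alpha> :: "'a::field fls"
  assumes "CHAR('a) = 3" "\<alpha> \<in> V1" "\<alpha> \<in> integral_series"
  shows "\<alpha> = fls_X * fps_to_fls (fps_compose (Abs_fps (\<lambda>n. \<alpha> $$ (3 * int n + 1))) (fps_X^3))"
proof (rule fls_eqI)
  fix n
  show "\<alpha> $$ n = (fls_X * fps_to_fls (fps_compose (Abs_fps (\<lambda>n. \<alpha> $$ (3 * int n + 1))) (fps_X^3))) $$ n"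
  proof (cases "n < 1")
    case True
    hence "n < 0 \<or> n = 0" by linarith
    thus ?thesis
      using assms(3) V1_nth_eq_0[OF assms(1,2), of 0]
      by (auto simp: fls_X_times_conv_shift integral_series_iff)
  next
    case False
    then obtain k where n: "n = int k + 1"
      by (metis add.commute diff_add_cancel diff_ge_0_iff_ge linorder_not_less nonneg_int_cases)
    show ?thesis
    proof (cases "3 dvd k")
      case True
      hence "3 * int (k div 3) = int k" by (auto elim!: dvdE)
      with True show ?thesis
        by (simp add: n fls_X_times_conv_shift fps_nth_compose_X_power)
    next
      case False
      hence "\<not> 3 dvd n - 1" using int_dvd_int_iff[of 3 k] by (simp add: n)
      thus ?thesis
        using False V1_nth_eq_0[OF assms(1,2), of n]
        by (simp add: n fls_X_times_conv_shift fps_nth_compose_X_power)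
    qed
  qed
qed

lemma separable_iff_cubic_E:
  fixes \<alpha> \<beta> \<gamma> :: "'a::field fls"
  assumes "CHAR('a) = 3" "A \<noteq> 0" "\<alpha> \<in> V1" "\<beta> \<in> V2" "\<gamma> \<in> V0"
  shows "\<alpha> + \<beta> + \<gamma> \<in> separable_formal_endomorphisms A B c \<longleftrightarrow>
    (\<alpha>, \<beta>, \<gamma>) \<in> cubic_E A B c \<and> \<alpha> + \<beta> + \<gamma> \<in> simple_pole_series"
  using cubic_E_iff[OF assms, of B c]
  by (auto simp: separable_formal_endomorphisms_def formal_endomorphisms_def simp del: fls_deriv_add)

text \<open>This gathers what both cases need to pass from an endomorphism to a point: the parts,
  their poles, and the low-order coefficients rewritten through the parts.\<close>

lemma separable_formal_endomorphism_decomposition: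
  fixes A B c :: "'a::field"
  assumes char: "CHAR('a) = 3" and "A \<noteq> 0"
    and \<eta>: "\<eta> \<in> separable_formal_endomorphisms A B c"
  obtains \<alpha> \<beta> \<gamma> where "\<eta> = \<alpha> + \<beta> + \<gamma>" "\<alpha> \<in> V1" "\<beta> \<in> V2" "\<gamma> \<in> V0"
    "(\<alpha>, \<beta>, \<gamma>) \<in> cubic_E A B c"
    "\<alpha> \<in> integral_series" "\<beta> \<in> simple_pole_series" "\<gamma> \<in> integral_series"
    "c^2 * B * (\<beta> $$ (-1))^2 = 0"
    "c^2 * A * (\<beta> $$ (-1))^2 = (\<beta> $$ (-1))^3"
    "c^2 * ((\<beta> $$ (-1))^2 + A * \<beta> $$ (-1) * \<alpha> $$ 1 + 2 * B * \<beta> $$ (-1) * \<beta> $$ 2)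
      = A * \<beta> $$ (-1)"
    "c^2 * (2 * A * \<beta> $$ (-1) * \<beta> $$ 2 + B * (\<alpha> $$ 1)^2) = (\<gamma> $$ 0)^3 + A * \<gamma> $$ 0 + B"
proof -
  obtain \<alpha> \<beta> \<gamma> where V: "\<alpha> \<in> V1" "\<beta> \<in> V2" "\<gamma> \<in> V0" and eq: "\<eta> = \<alpha> + \<beta> + \<gamma>"
    using ex_V_decomposition[OF char] .
  have E: "(\<alpha>, \<beta>, \<gamma>) \<in> cubic_E A B c" and pole: "\<alpha> + \<beta> + \<gamma> \<in> simple_pole_series"
    using \<eta> separable_iff_cubic_E[OF char \<open>A \<noteq> 0\<close> V] by (simp_all add: eq)
  have "fls_const (c^2) * (fls_X^3 + fls_const A * fls_X + fls_const B) *
      (fls_deriv (\<alpha> + \<beta> + \<gamma>))^2 = (\<alpha> + \<beta> + \<gamma>)^3 + fls_const A * (\<alpha> + \<beta> + \<gamma>) + fls_const B"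
    using \<eta> unfolding separable_formal_endomorphisms_def formal_endomorphisms_def eq by blast
  note coeffs = isogeny_equation_coeffs[OF char pole this, unfolded V_sum_nth[OF char V]]
  show ?thesis
    by (rule that[OF eq V E simple_pole_series_parts[OF char V pole] coeffs])
qed

theorem theorem2p1:
  fixes A B c :: "'a::field"
  assumes "CHAR('a) = 3"
    and "elliptic_curve A B"
    and "c \<noteq> 0"
  shows "(B \<noteq> 0 \<longrightarrow>
            bij_betw (\<lambda>(\<alpha>, \<beta>, \<gamma>). \<alpha> + \<beta> + \<gamma>)
              (points_B_nonzero A B c) (separable_formal_endomorphisms A B c)) \<and>
         (B = 0 \<longrightarrow>
            bij_betw (\<lambda>(\<alpha>, \<beta>, \<gamma>). \<alpha> + \<beta> + \<gamma>)
              (points_B_zero A c) (separable_formal_endomorphisms A B c))"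
proof (intro conjI impI)
  note char = assms(1)
  have A: "A \<noteq> 0"
    using elliptic_curve_CHAR_3_imp_nonzero[OF assms(1,2)] .
  {
    assume "B \<noteq> 0"
    show "bij_betw (\<lambda>(\<alpha>, \<beta>, \<gamma>). \<alpha> + \<beta> + \<gamma>) (points_B_nonzero A B c)
      (separable_formal_endomorphisms A B c)"
    proof (rule bij_betw_imageI)
      show "inj_on (\<lambda>(\<alpha>, \<beta>, \<gamma>). \<alpha> + \<beta> + \<gamma>) (points_B_nonzero A B c)"
        by (rule inj_on_V_sum[OF char]) (auto simp: points_B_nonzero_def)
      show "(\<lambda>(\<alpha>, \<beta>, \<gamma>). \<alpha> + \<beta> + \<gamma>) ` points_B_nonzero A B c = separable_formal_endomorphisms A B c"
      proof (intro equalityI subsetI)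
        fix \<eta> assume "\<eta> \<in> (\<lambda>(\<alpha>, \<beta>, \<gamma>). \<alpha> + \<beta> + \<gamma>) ` points_B_nonzero A B c"
        thus "\<eta> \<in> separable_formal_endomorphisms A B c"
          using separable_iff_cubic_E[OF char A]
          by (auto simp: points_B_nonzero_def simple_pole_series_iff integral_series_iff)
      next
        fix \<eta> assume "\<eta> \<in> separable_formal_endomorphisms A B c"
        then obtain \<alpha> \<beta> \<gamma> where *: "\<eta> = \<alpha> + \<beta> + \<gamma>" "\<alpha> \<in> V1" "\<beta> \<in> V2" "\<gamma> \<in> V0"
          "(\<alpha>, \<beta>, \<gamma>) \<in> cubic_E A B c" "\<alpha> \<in> integral_series" "\<gamma> \<in> integral_series"
          and \<beta>: "\<beta> \<in> simple_pole_series" "c^2 * B * (\<beta> $$ (-1))^2 = 0"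
          and const: "c^2 * (2 * A * \<beta> $$ (-1) * \<beta> $$ 2 + B * (\<alpha> $$ 1)^2)
            = (\<gamma> $$ 0)^3 + A * \<gamma> $$ 0 + B"
          by (rule separable_formal_endomorphism_decomposition[OF char A])
        \<comment> \<open>The coefficient of X^-4 excludes a pole when \<open>B\<close> and
          \<open>c\<close> are nonzero, so \<beta> is integral.\<close>
        have "\<beta> $$ (-1) = 0" using \<beta>(2) \<open>B \<noteq> 0\<close> \<open>c \<noteq> 0\<close> by simp
        moreover have "n < -1 \<or> n = -1" if "n < 0" for n :: int using that by linarith
        ultimately have "\<beta> \<in> integral_series"
          using \<beta>(1) unfolding simple_pole_series_iff integral_series_iff by metis
        \<comment> \<open>The witness for \<open>k\<close> is the constant coefficient of
          \<gamma>.\<close>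
        moreover have "(\<gamma> $$ 0)^3 + A * \<gamma> $$ 0 = c^2 * B * (\<alpha> $$ 1)^2 - B"
          using const \<open>\<beta> $$ (-1) = 0\<close> by (simp add: algebra_simps)
        ultimately have "(\<alpha>, \<beta>, \<gamma>) \<in> points_B_nonzero A B c"
          using * by (auto simp: points_B_nonzero_def)
        thus "\<eta> \<in> (\<lambda>(\<alpha>, \<beta>, \<gamma>). \<alpha> + \<beta> + \<gamma>) ` points_B_nonzero A B c"
          using *(1) by force
      qed
    qed
  next
    assume B: "B = 0"
    show "bij_betw (\<lambda>(\<alpha>, \<beta>, \<gamma>). \<alpha> + \<beta> + \<gamma>) (points_B_zero A c)
      (separable_formal_endomorphisms A B c)"
    proof (rule bij_betw_imageI)
      show "inj_on (\<lambda>(\<alpha>, \<beta>, \<gamma>). \<alpha> + \<beta> + \<gamma>) (points_B_zero A c)"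
        by (rule inj_on_V_sum[OF char]) (auto simp: points_B_zero_def)
      show "(\<lambda>(\<alpha>, \<beta>, \<gamma>). \<alpha> + \<beta> + \<gamma>) ` points_B_zero A c = separable_formal_endomorphisms A B c"
      proof (intro equalityI subsetI)
        fix \<eta> assume "\<eta> \<in> (\<lambda>(\<alpha>, \<beta>, \<gamma>). \<alpha> + \<beta> + \<gamma>) ` points_B_zero A c"
        then obtain \<alpha> \<beta> \<gamma> \<delta> where eq: "\<eta> = \<alpha> + \<beta> + \<gamma>"
          and V: "\<alpha> \<in> V1" "\<beta> \<in> V2" "\<gamma> \<in> V0" and E: "(\<alpha>, \<beta>, \<gamma>) \<in> cubic_E A B c"
          and \<beta>: "\<beta> \<in> simple_pole_series"
          and \<alpha>: "\<alpha> = fls_X * fps_to_fls (fps_compose \<delta> (fps_X^3))"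
          by (auto simp: points_B_zero_def B)
        have "\<alpha> \<in> simple_pole_series"
          by (simp add: \<alpha> simple_pole_series_iff fls_X_times_conv_shift)
        \<comment> \<open>\<open>points_B_zero\<close> does not state integrality of \<gamma>; it
          follows from the second equation once the poles of \<alpha> and \<beta> are
          bounded.\<close>
        moreover from this have "\<gamma> \<in> integral_series"
          using cubic_E_V0_part_integral[OF char E] V \<beta> by simp
        ultimately have "\<eta> \<in> simple_pole_series"
          using \<beta> by (simp add: eq simple_pole_series_iff integral_series_iff)
        thus "\<eta> \<in> separable_formal_endomorphisms A B c"
          using separable_iff_cubic_E[OF char A V] E eq by simp
      next
        fix \<eta> assume "\<eta> \<in> separable_formal_endomorphisms A B c"
        then obtain \<alpha> \<beta> \<gamma> where eq: "\<eta> = \<alpha> + \<beta> + \<gamma>"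
          and V: "\<alpha> \<in> V1" "\<beta> \<in> V2" "\<gamma> \<in> V0" and E: "(\<alpha>, \<beta>, \<gamma>) \<in> cubic_E A B c"
          and \<alpha>: "\<alpha> \<in> integral_series" and \<beta>: "\<beta> \<in> simple_pole_series"
          and coeffs: "c^2 * A * (\<beta> $$ (-1))^2 = (\<beta> $$ (-1))^3"
            "c^2 * ((\<beta> $$ (-1))^2 + A * \<beta> $$ (-1) * \<alpha> $$ 1 + 2 * B * \<beta> $$ (-1) * \<beta> $$ 2)
              = A * \<beta> $$ (-1)"
            "c^2 * (2 * A * \<beta> $$ (-1) * \<beta> $$ 2 + B * (\<alpha> $$ 1)^2)
              = (\<gamma> $$ 0)^3 + A * \<gamma> $$ 0 + B"
          by (rule separable_formal_endomorphism_decomposition[OF char A])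
        define \<delta> where "\<delta> = Abs_fps (\<lambda>n. \<alpha> $$ (3 * int n + 1))"
        have "fls_const (c^2 * A) * (fls_X * \<alpha>) + fls_const (c^2) * (fls_X^3 * \<beta>)
            = fls_const A * fls_X^2"
          using E by (simp add: cubic_E_def B mult.assoc)
        \<comment> \<open>The coefficient of X^2 in the linear equation links \<alpha> at exponent
          1, which is the constant term of \<delta>, with \<beta> at exponent -1.\<close>
        hence "(fls_const (c^2 * A) * (fls_X * \<alpha>) + fls_const (c^2) * (fls_X^3 * \<beta>)) $$ 2
            = (fls_const A * fls_X^2) $$ 2"
          by (rule arg_cong)
        hence "c^2 * A * \<alpha> $$ 1 + c^2 * \<beta> $$ (-1) = A"
          by (simp add: mult.assoc fls_X_times_conv_shift fls_X_power_times_conv_shift)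
        hence "\<beta> $$ (-1) = A / c^2 - A * \<delta> $ 0"
          using \<open>c \<noteq> 0\<close> by (simp add: \<delta>_def field_simps)
        moreover have "\<alpha> = fls_X * fps_to_fls (fps_compose \<delta> (fps_X^3))"
          unfolding \<delta>_def by (rule V1_integral_eq_compose[OF char V(1) \<alpha>])
        \<comment> \<open>With \<open>B = 0\<close> these are the coefficients of X^-3, X^-1 and
          X^0; the constant coefficient of \<gamma> serves as \<open>T\<close>.\<close>
        moreover have "c^2 * A * (\<beta> $$ (-1))^2 - (\<beta> $$ (-1))^3 = 0"
          "c^2 * ((\<beta> $$ (-1))^2 + A * \<alpha> $$ 1 * \<beta> $$ (-1)) - A * \<beta> $$ (-1) = 0"
          "(\<gamma> $$ 0)^3 + A * \<gamma> $$ 0 = 2 * c^2 * A * \<beta> $$ (-1) * \<beta> $$ 2"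
          using coeffs by (simp_all add: B mult_ac)
        ultimately have "(\<alpha>, \<beta>, \<gamma>) \<in> points_B_zero A c"
          using V E \<beta> unfolding points_B_zero_def B by blast
        thus "\<eta> \<in> (\<lambda>(\<alpha>, \<beta>, \<gamma>). \<alpha> + \<beta> + \<gamma>) ` points_B_zero A c"
          using eq by force
      qed
    qed
  }
qed

end
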